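(* Let $(\mathcal{A},\mu_{\mathcal{A}},\alpha)$ and $(\mathcal{B},\mu_{\mathcal{B}},\alpha')$ be multiplicative Hom-associative algebras over $\mathbb{K}$ and let $\phi:\mathcal{A}\to\mathcal{B}$ be a Hom-associative algebra morphism. For $n\ge 1$ let $\delta^n:C^n_{Hom}(\phi,\phi)\to C^{n+1}_{Hom}(\phi,\phi)$ be $$\delta^n(\varphi_1,\varphi_2,\varphi_3)=\big(\delta^n_{Hom}\varphi_1,\ \delta^n_{Hom}\varphi_2,\ \phi\circ\varphi_1-\varphi_2\circ\phi^{\otimes n}-\delta^{n-1}_{Hom}\varphi_3\big).$$ Then $\delta^{n+1}\circ\delta^n=0$. Hence $(C^*_{Hom}(\phi,\phi),\delta^n)$ is a cochain complex.
   Context: $\mathbb{K}$ is an algebraically closed field of characteristic $0$. A Hom-associative algebra $(\mathcal{A},\mu,\alpha)$ is a vector space with a bilinear map $\mu$ and a linear map $\alpha$ such that $\mu(\alpha(x),\mu(y,z))=\mu(\mu(x,y),\alpha(z))$; it is multiplicative if $\alpha\circ\mu=\mu\circ(\alpha\otimes\alpha)$. A morphism $\phi:\mathcal{A}\to\mathcal{B}$ is a linear map with $\mu_{\mathcal{B}}\circ(\phi\otimes\phi)=\phi\circ\mu_{\mathcal{A}}$ and $\phi\circ\alpha=\alpha'\circ\phi$. Cochains: for $n\ge1$, $C^n_{\alpha,\alpha'}(\mathcal{A},\mathcal{B})$ is the space of $n$-linear maps $f:\mathcal{A}^{\times n}\to\mathcal{B}$ with $\alpha'(f(u_1,\dots,u_n))=f(\alpha(u_1),\dots,\alpha(u_n))$,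 and $C^0_{\alpha,\alpha'}(\mathcal{A},\mathcal{B})=\mathcal{B}$. For $n\ge1$, $\delta^n_{Hom}:C^n_{\alpha,\alpha'}(\mathcal{A},\mathcal{B})\to C^{n+1}_{\alpha,\alpha'}(\mathcal{A},\mathcal{B})$ is $$\delta^n_{Hom}\varphi(x_0,\dots,x_n)=\mu_{\mathcal{B}}(\phi(\alpha^{n-1}(x_0)),\varphi(x_1,\dots,x_n))+\sum_{k=1}^n(-1)^k\varphi(\alpha(x_0),\dots,\alpha(x_{k-2}),\mu_{\mathcal{A}}(x_{k-1},x_k),\alpha(x_{k+1}),\dots,\alpha(x_n))+(-1)^{n+1}\mu_{\mathcal{B}}(\varphi(x_0,\dots,x_{n-1}),\phi(\alpha^{n-1}(x_n))).$$ $C^n_{Hom}(\mathcal{A},\mathcal{A})$ and $C^n_{Hom}(\mathcal{B},\mathcal{B})$, with their operators $\delta^n_{Hom}$, are the case $\phi=\mathrm{id}$ of this. The module of $n$-cochains of $\phi$ is $C^n_{Hom}(\phi,\phi)=C^n_{Hom}(\mathcal{A},\mathcal{A})\times C^n_{Hom}(\mathcal{B},\mathcal{B})\times C^{n-1}_{\alpha,\alpha'}(\mathcal{A},\mathcal{B})$. Convention: $\delta^0_{Hom}=0$ (so the third component plays no role in $\delta^1$). *)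

theory Defs
  imports
    "HOL-Computational_Algebra.Polynomial"
    "HOL-Library.Function_Algebras"
    "HOL-Library.Product_Plus"
begin

locale hom_assoc_algebra = vector_space scale
  for scale :: "'k::field \<Rightarrow> 'a::ab_group_add \<Rightarrow> 'a"
  and \<mu> :: "'a \<Rightarrow> 'a \<Rightarrow> 'a"
  and \<alpha> :: "'a \<Rightarrow> 'a" +
  assumes mult_linear_left: "\<And>y. Vector_Spaces.linear scale scale (\<lambda>x. \<mu> x y)"
    and mult_linear_right: "\<And>x. Vector_Spaces.linear scale scale (\<mu> x)"
    and twist_linear: "Vector_Spaces.linear scale scale \<alpha>"
    and hom_assoc: "\<And>x y z. \<mu> (\<alpha> x) (\<mu> y z) = \<mu> (\<mu> x y) (\<alpha> z)"

locale multiplicative_hom_assoc_algebra = hom_assoc_algebra +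
  assumes twist_mult: "\<And>x y. \<alpha> (\<mu> x y) = \<mu> (\<alpha> x) (\<alpha> y)"

locale hom_assoc_morphism =
  A: hom_assoc_algebra sA \<mu>A \<alpha> + B: hom_assoc_algebra sB \<mu>B \<alpha>'
  for sA :: "'k::field \<Rightarrow> 'a::ab_group_add \<Rightarrow> 'a"
  and \<mu>A :: "'a \<Rightarrow> 'a \<Rightarrow> 'a"
  and \<alpha> :: "'a \<Rightarrow> 'a"
  and sB :: "'k \<Rightarrow> 'b::ab_group_add \<Rightarrow> 'b"
  and \<mu>B :: "'b \<Rightarrow> 'b \<Rightarrow> 'b"
  and \<alpha>' :: "'b \<Rightarrow> 'b"
  and \<phi> :: "'a \<Rightarrow> 'b" +
  assumes hom_linear: "Vector_Spaces.linear sA sB \<phi>"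
    and hom_mult: "\<And>x y. \<mu>B (\<phi> x) (\<phi> y) = \<phi> (\<mu>A x y)"
    and hom_twist: "\<And>x. \<phi> (\<alpha> x) = \<alpha>' (\<phi> x)"

text \<open>
  A map in \<open>n\<close> arguments is represented by a function on lists that is zero on lists of
  length other than \<open>n\<close>. This makes the representation unique, so that equality of functions
  is equality of cochains and the pointwise operations on functions are those of cochains.
\<close>

definition multilinear_map ::
  "('k::field \<Rightarrow> 'a::ab_group_add \<Rightarrow> 'a) \<Rightarrow> ('k \<Rightarrow> 'b::ab_group_add \<Rightarrow> 'b) \<Rightarrow> nat \<Rightarrow>
    ('a list \<Rightarrow> 'b) \<Rightarrow> bool"
where
  "multilinear_map sA sB n f \<longleftrightarrow>
    (\<forall>xs. length xs \<noteq> n \<longrightarrow> f xs = 0) \<and>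
    (\<forall>xs i. length xs = n \<longrightarrow> i < n \<longrightarrow> Vector_Spaces.linear sA sB (\<lambda>x. f (xs[i := x])))"

text \<open>
  In degree \<open>0\<close> there is no compatibility with the twists: the cochain space is all of the
  target, a cochain \<open>f\<close> being identified with its value \<open>f []\<close>.
\<close>

definition hom_cochains ::
  "('k::field \<Rightarrow> 'a::ab_group_add \<Rightarrow> 'a) \<Rightarrow> ('a \<Rightarrow> 'a) \<Rightarrow>
    ('k \<Rightarrow> 'b::ab_group_add \<Rightarrow> 'b) \<Rightarrow> ('b \<Rightarrow> 'b) \<Rightarrow> nat \<Rightarrow> ('a list \<Rightarrow> 'b) set"
where
  "hom_cochains sA \<alpha> sB \<alpha>' n =
    {f. multilinear_map sA sB n f \<and>
        (n \<ge> 1 \<longrightarrow> (\<forall>xs. length xs = n \<longrightarrow> \<alpha>' (f xs) = f (map \<alpha> xs)))}"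

text \<open>The list \<open>xs\<close> below is \<open>[x\<^sub>0, \<dots>, x\<^sub>n]\<close>, of length \<open>n + 1\<close>.\<close>

definition hom_delta ::
  "('a \<Rightarrow> 'a \<Rightarrow> 'a) \<Rightarrow> ('a \<Rightarrow> 'a) \<Rightarrow>
    ('k::field \<Rightarrow> 'b::ab_group_add \<Rightarrow> 'b) \<Rightarrow> ('b \<Rightarrow> 'b \<Rightarrow> 'b) \<Rightarrow> ('a \<Rightarrow> 'b) \<Rightarrow>
    nat \<Rightarrow> ('a list \<Rightarrow> 'b) \<Rightarrow> ('a list \<Rightarrow> 'b)"
where
  "hom_delta \<mu>A \<alpha> sB \<mu>B \<phi> n f =
    (\<lambda>xs. if n = 0 \<or> length xs \<noteq> n + 1 then 0 else
       \<mu>B (\<phi> ((\<alpha> ^^ (n - 1)) (xs ! 0))) (f (drop 1 xs))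
       + (\<Sum>k = 1..n. sB ((- 1) ^ k)
            (f (map \<alpha> (take (k - 1) xs) @ [\<mu>A (xs ! (k - 1)) (xs ! k)] @ map \<alpha> (drop (k + 1) xs))))
       + sB ((- 1) ^ (n + 1)) (\<mu>B (f (take n xs)) (\<phi> ((\<alpha> ^^ (n - 1)) (xs ! n)))))"

definition morphism_cochains ::
  "('k::field \<Rightarrow> 'a::ab_group_add \<Rightarrow> 'a) \<Rightarrow> ('a \<Rightarrow> 'a) \<Rightarrow>
    ('k \<Rightarrow> 'b::ab_group_add \<Rightarrow> 'b) \<Rightarrow> ('b \<Rightarrow> 'b) \<Rightarrow> nat \<Rightarrow>
    (('a list \<Rightarrow> 'a) \<times> ('b list \<Rightarrow> 'b) \<times> ('a list \<Rightarrow> 'b)) set"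
where
  "morphism_cochains sA \<alpha> sB \<alpha>' n =
    hom_cochains sA \<alpha> sA \<alpha> n \<times> hom_cochains sB \<alpha>' sB \<alpha>' n \<times> hom_cochains sA \<alpha> sB \<alpha>' (n - 1)"

definition morphism_scale ::
  "('k::field \<Rightarrow> 'a::ab_group_add \<Rightarrow> 'a) \<Rightarrow> ('k \<Rightarrow> 'b::ab_group_add \<Rightarrow> 'b) \<Rightarrow> 'k \<Rightarrow>
    ('a list \<Rightarrow> 'a) \<times> ('b list \<Rightarrow> 'b) \<times> ('a list \<Rightarrow> 'b) \<Rightarrow>
    ('a list \<Rightarrow> 'a) \<times> ('b list \<Rightarrow> 'b) \<times> ('a list \<Rightarrow> 'b)"
where
  "morphism_scale sA sB c =
    (\<lambda>(f1, f2, f3). (\<lambda>xs. sA c (f1 xs), \<lambda>xs. sB c (f2 xs), \<lambda>xs. sB c (f3 xs)))"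

definition morphism_delta ::
  "('k::field \<Rightarrow> 'a::ab_group_add \<Rightarrow> 'a) \<Rightarrow> ('a \<Rightarrow> 'a \<Rightarrow> 'a) \<Rightarrow> ('a \<Rightarrow> 'a) \<Rightarrow>
    ('k \<Rightarrow> 'b::ab_group_add \<Rightarrow> 'b) \<Rightarrow> ('b \<Rightarrow> 'b \<Rightarrow> 'b) \<Rightarrow> ('b \<Rightarrow> 'b) \<Rightarrow> ('a \<Rightarrow> 'b) \<Rightarrow>
    nat \<Rightarrow> ('a list \<Rightarrow> 'a) \<times> ('b list \<Rightarrow> 'b) \<times> ('a list \<Rightarrow> 'b) \<Rightarrow>
    ('a list \<Rightarrow> 'a) \<times> ('b list \<Rightarrow> 'b) \<times> ('a list \<Rightarrow> 'b)"
where
  "morphism_delta sA \<mu>A \<alpha> sB \<mu>B \<alpha>' \<phi> n =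
    (\<lambda>(f1, f2, f3).
      (hom_delta \<mu>A \<alpha> sA \<mu>A id n f1,
       hom_delta \<mu>B \<alpha>' sB \<mu>B id n f2,
       \<lambda>xs. \<phi> (f1 xs) - f2 (map \<phi> xs) - hom_delta \<mu>A \<alpha> sB \<mu>B \<phi> (n - 1) f3 xs))"

text \<open>
  Cochain complexes of vector spaces in degrees \<open>n \<ge> 1\<close>, where all terms \<open>C n\<close> are subspaces
  of one ambient vector space; only the values of \<open>d n\<close> on \<open>C n\<close> matter.
\<close>

definition cochain_complex ::
  "('k::field \<Rightarrow> 'v::ab_group_add \<Rightarrow> 'v) \<Rightarrow> (nat \<Rightarrow> 'v set) \<Rightarrow> (nat \<Rightarrow> 'v \<Rightarrow> 'v) \<Rightarrow> bool"
where
  "cochain_complex scale C d \<longleftrightarrow>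
    vector_space scale \<and>
    (\<forall>n\<ge>1. module.subspace scale (C n) \<and>
      (\<forall>c\<in>C n. d n c \<in> C (n + 1)) \<and>
      (\<forall>c\<in>C n. \<forall>c'\<in>C n. d n (c + c') = d n c + d n c') \<and>
      (\<forall>r. \<forall>c\<in>C n. d n (scale r c) = scale r (d n c)) \<and>
      (\<forall>c\<in>C n. d (n + 1) (d n c) = 0))"

end

theory Submission
  imports Defs
begin

text \<open>
  For a morphism \<open>\<phi>\<close>, the Hochschild-type operator \<open>\<delta>\<close> (\<open>hom_delta\<close>) in degree \<open>n\<close> is the alternating sum of
  \<open>n + 2\<close> coface operators, and Hom-associativity, multiplicativity and the compatibility of
  cochains with the twists give the cosimplicial identities \<open>D\<^sub>j D\<^sub>i = D\<^sub>i D\<^sub>j\<^sub>-\<^sub>1\<close> for \<open>i < j\<close>. Hence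
  \<open>\<delta>\<close> squares to zero. Composition with \<open>\<phi>\<close> on either side commutes with \<open>\<delta>\<close>, and
  the complex of \<open>\<phi>\<close> is the mapping cone of the difference of these two cochain maps.
\<close>

text \<open>The bijection \<open>(j, i)\<close> to \<open>(i, j - 1)\<close> from the pairs with
  \<open>i < j\<close> to the remaining pairs preserves the value of \<open>F\<close> and flips the
  sign, so the terms cancel in pairs.\<close>

lemma (in vector_space) alternating_double_sum_eq_0:
  fixes F :: "nat \<Rightarrow> nat \<Rightarrow> 'b"
  assumes "\<And>i j. i < j \<Longrightarrow> j \<le> Suc m \<Longrightarrow> F j i = F i (j - 1)"
  shows "(\<Sum>j\<le>Suc m. \<Sum>i\<le>m. ((- 1) ^ j * (- 1) ^ i) *s F j i) = 0"
proof -
  let ?t = "\<lambda>p. ((- 1) ^ fst p * (- 1) ^ snd p) *s F (fst p) (snd p)"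
  let ?S = "{..Suc m} \<times> {..m}"
  let ?L = "{p \<in> ?S. snd p < fst p}" and ?U = "{p \<in> ?S. \<not> snd p < fst p}"
  have "sum ?t ?L = (\<Sum>p\<in>?U. - ?t p)"
  proof (rule sum.reindex_bij_witness[where j = "\<lambda>(j, i). (i, j - 1)" and i = "\<lambda>(j, i). (Suc i, j)"])
    fix p assume "p \<in> ?L"
    then obtain j i where p: "p = (j, i)" "i < j" "j \<le> Suc m" by auto
    then obtain j' where j': "j = Suc j'" by (cases j) auto
    have "F j i = F i j'" using assms[of i j] p j' by simp
    then show "- ?t ((\<lambda>(j, i). (i, j - 1)) p) = ?t p"
      using p(1) j' by (simp add: mult.commute)
  qed auto
  then have "sum ?t ?L + sum ?t ?U = 0" by (simp add: sum_negf)
  moreover have "sum ?t ?S = sum ?t ?L + sum ?t ?U"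
  proof -
    have "?S = ?L \<union> ?U" by blast
    then have "sum ?t ?S = sum ?t (?L \<union> ?U)" by simp
    also have "\<dots> = sum ?t ?L + sum ?t ?U"
      by (rule sum.union_disjoint) auto
    finally show ?thesis .
  qed
  ultimately show ?thesis by (simp add: sum.cartesian_product case_prod_beta)
qed

section \<open>Face operators on argument lists\<close>

text \<open>Meaningful only for \<open>k \<ge> 1\<close>, because of the truncated subtraction.\<close>

definition face :: "('a \<Rightarrow> 'a \<Rightarrow> 'a) \<Rightarrow> ('a \<Rightarrow> 'a) \<Rightarrow> nat \<Rightarrow> 'a list \<Rightarrow> 'a list" where
  "face \<mu> \<alpha> k xs =
    map \<alpha> (take (k - 1) xs) @ [\<mu> (xs ! (k - 1)) (xs ! k)] @ map \<alpha> (drop (k + 1) xs)"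

lemma length_face [simp]: "1 \<le> k \<Longrightarrow> k < length xs \<Longrightarrow> length (face \<mu> \<alpha> k xs) = length xs - 1"
  by (auto simp: face_def)

text \<open>This entrywise form turns identities between lists of faces into case distinctions on
  one index.\<close>

lemma nth_face:
  assumes "1 \<le> k" "k < length xs" "m < length xs - 1"
  shows "face \<mu> \<alpha> k xs ! m =
    (if m < k - 1 then \<alpha> (xs ! m) else if m = k - 1 then \<mu> (xs ! m) (xs ! Suc m)
     else \<alpha> (xs ! Suc m))"
  using assms by (auto simp: face_def nth_append min_def nth_Cons' intro!: arg_cong[where f = "\<lambda>i. xs ! i"])

lemma map_face:
  assumes "\<And>x y. g (\<mu> x y) = \<mu>' (g x) (g y)" "\<And>x. g (\<alpha> x) = \<alpha>' (g x)" "1 \<le> k" "k < length xs"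
  shows "map g (face \<mu> \<alpha> k xs) = face \<mu>' \<alpha>' k (map g xs)"
  using assms by (simp add: face_def take_map drop_map)

text \<open>This and the next three lemmas describe how a face interacts with removing an end
  argument, as the outer cofaces do. A face away from that end survives; a face at that end leaves
  only the twist on the remaining arguments.\<close>

lemma drop_face:
  assumes "2 \<le> k" "k < length xs"
  shows "drop 1 (face \<mu> \<alpha> k xs) = face \<mu> \<alpha> (k - 1) (drop 1 xs)"
  using assms by (intro nth_equalityI) (auto simp: nth_face)

lemma take_face:
  assumes "1 \<le> k" "k \<le> n" "length xs = n + 2"
  shows "take n (face \<mu> \<alpha> k xs) = face \<mu> \<alpha> k (take (Suc n) xs)"
  using assms by (intro nth_equalityI) (auto simp: nth_face)

lemma take_face_last:
  assumes "length xs = n + 2"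
  shows "take n (face \<mu> \<alpha> (Suc n) xs) = map \<alpha> (take n xs)"
  using assms by (intro nth_equalityI) (auto simp: nth_face)

lemma drop_face_first:
  assumes "2 \<le> length xs"
  shows "drop 1 (face \<mu> \<alpha> 1 xs) = map \<alpha> (drop 2 xs)"
  using assms by (intro nth_equalityI) (auto simp: nth_face)

text \<open>Changing one argument changes one entry of the face, through the twist or a one-sided
  product. Multilinearity of the inner cofaces reduces to this.\<close>

lemma face_list_update:
  assumes "1 \<le> k" "k < length xs" "m < length xs"
  shows "face \<mu> \<alpha> k (xs[m := x]) =
    (if m < k - 1 then (face \<mu> \<alpha> k xs)[m := \<alpha> x]
     else if m = k - 1 then (face \<mu> \<alpha> k xs)[k - 1 := \<mu> x (xs ! k)]
     else if m = k then (face \<mu> \<alpha> k xs)[k - 1 := \<mu> (xs ! (k - 1)) x]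
     else (face \<mu> \<alpha> k xs)[m - 1 := \<alpha> x])"
  using assms by (intro nth_equalityI) (auto simp: nth_face nth_list_update)

context multiplicative_hom_assoc_algebra
begin

text \<open>Adjacent faces produce the two bracketings of a triple product, which Hom-associativity
  identifies. For disjoint faces, the product merged first is twisted by the second face, and
  multiplicativity compares this with twisting before merging.\<close>

lemma face_face:
  assumes "1 \<le> i" "i < j" "j < length xs"
  shows "face \<mu> \<alpha> i (face \<mu> \<alpha> j xs) = face \<mu> \<alpha> (j - 1) (face \<mu> \<alpha> i xs)"
proof (rule nth_equalityI)
  show "length (face \<mu> \<alpha> i (face \<mu> \<alpha> j xs)) = length (face \<mu> \<alpha> (j - 1) (face \<mu> \<alpha> i xs))"
    using assms by simp
next
  fix m assume "m < length (face \<mu> \<alpha> i (face \<mu> \<alpha> j xs))"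
  then have m: "m < length xs - 2" using assms by simp
  \<comment> \<open>After both merges the list has two entries fewer; the products stand at
    positions \<open>i - 1\<close> and \<open>j - 2\<close>, which coincide when
    \<open>j = Suc i\<close>.\<close>
  consider "m < i - 1" | "m = i - 1" "j = Suc i" | "m = i - 1" "Suc i < j"
    | "i - 1 < m" "m < j - 2" | "i - 1 < m" "m = j - 2" | "i - 1 < m" "j - 2 < m"
    using assms by arith
  then show "face \<mu> \<alpha> i (face \<mu> \<alpha> j xs) ! m = face \<mu> \<alpha> (j - 1) (face \<mu> \<alpha> i xs) ! m"
    using assms m by cases (auto simp: nth_face hom_assoc twist_mult)
qed

lemma twist_power_mult: "(\<alpha> ^^ n) (\<mu> x y) = \<mu> ((\<alpha> ^^ n) x) ((\<alpha> ^^ n) y)"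
  by (induction n) (auto simp: twist_mult)

end

lemma (in hom_assoc_algebra) twist_power_linear: "Vector_Spaces.linear scale scale (\<alpha> ^^ n)"
proof (induction n)
  case 0
  show ?case using linear_id by (simp add: id_def)
next
  case (Suc n)
  then show ?case using Vector_Spaces.linear_compose[OF Suc twist_linear] by (simp add: o_def)
qed

section \<open>Coface operators of a morphism and the square of the differential\<close>

locale multiplicative_hom_assoc_morphism =
  hom_assoc_morphism sA \<mu>A \<alpha> sB \<mu>B \<alpha>' \<phi> +
  A: multiplicative_hom_assoc_algebra sA \<mu>A \<alpha> +
  B: multiplicative_hom_assoc_algebra sB \<mu>B \<alpha>'
  for sA :: "'k::field \<Rightarrow> 'a::ab_group_add \<Rightarrow> 'a"
  and \<mu>A :: "'a \<Rightarrow> 'a \<Rightarrow> 'a"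
  and \<alpha> :: "'a \<Rightarrow> 'a"
  and sB :: "'k \<Rightarrow> 'b::ab_group_add \<Rightarrow> 'b"
  and \<mu>B :: "'b \<Rightarrow> 'b \<Rightarrow> 'b"
  and \<alpha>' :: "'b \<Rightarrow> 'b"
  and \<phi> :: "'a \<Rightarrow> 'b"
begin

sublocale AB: vector_space_pair sA sB ..

sublocale BB: vector_space_pair sB sB ..

lemma hom_twist_power: "\<phi> ((\<alpha> ^^ n) x) = (\<alpha>' ^^ n) (\<phi> x)"
  by (induction n) (auto simp: hom_twist)

abbreviation "C \<equiv> hom_cochains sA \<alpha> sB \<alpha>'"

abbreviation "\<delta> \<equiv> hom_delta \<mu>A \<alpha> sB \<mu>B \<phi>"

text \<open>The parameter \<open>n\<close> is the degree of \<open>f\<close>. It fixes the power of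
  the twist in the two outer cofaces and the index from which the last one applies.\<close>

definition coface :: "nat \<Rightarrow> nat \<Rightarrow> ('a list \<Rightarrow> 'b) \<Rightarrow> 'a list \<Rightarrow> 'b" where
  "coface n i f xs =
    (if length xs \<noteq> n + 1 then 0
     else if i = 0 then \<mu>B (\<phi> ((\<alpha> ^^ (n - 1)) (xs ! 0))) (f (drop 1 xs))
     else if i \<le> n then f (face \<mu>A \<alpha> i xs)
     else \<mu>B (f (take n xs)) (\<phi> ((\<alpha> ^^ (n - 1)) (xs ! n))))"

text \<open>In degree 0 the two outer cofaces would give a commutator with the value of
  \<open>f\<close>, whereas \<open>\<delta> 0\<close> is zero by convention; hence the restriction
  to \<open>n \<ge> 1\<close>.\<close>

lemma hom_delta_eq_sum_coface:
  assumes "n \<ge> 1"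
  shows "\<delta> n f xs = (\<Sum>i\<le>Suc n. sB ((- 1) ^ i) (coface n i f xs))"
proof (cases "length xs = n + 1")
  case True
  have "(\<Sum>i\<le>Suc n. sB ((- 1) ^ i) (coface n i f xs)) =
    coface n 0 f xs + (\<Sum>i = 1..n. sB ((- 1) ^ i) (coface n i f xs))
      + sB ((- 1) ^ Suc n) (coface n (Suc n) f xs)"
    by (simp add: atMost_atLeast0 sum.atLeast_Suc_atMost)
  then show ?thesis
    using True assms by (simp add: hom_delta_def coface_def face_def)
next
  case False
  then show ?thesis by (simp add: hom_delta_def coface_def)
qed

lemma hom_delta_0: "\<delta> 0 f xs = 0"
  by (simp add: hom_delta_def)

text \<open>Since \<open>L\<close> and \<open>ys\<close> do not depend on \<open>f\<close>,
  linearity of a coface in \<open>f\<close> follows from that of \<open>L\<close>, without repeating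
  the case distinction.\<close>

lemma coface_eq_linear:
  obtains L ys where "Vector_Spaces.linear sB sB L" "\<And>f. coface n i f xs = L (f ys)"
proof -
  consider "length xs \<noteq> n + 1" | "length xs = n + 1" "i = 0"
    | "length xs = n + 1" "i \<noteq> 0" "i \<le> n" | "length xs = n + 1" "n < i" by linarith
  then show thesis
  proof cases
    case 1
    then show thesis
      \<comment> \<open>On lists of the wrong length the coface is zero, so the zero map serves and
        the list \<open>[]\<close> is arbitrary.\<close>
      using that[of "\<lambda>_. 0" "[]"] BB.linear_zero by (simp add: coface_def)
  next
    case 2
    then show thesis
      using that[of "\<mu>B (\<phi> ((\<alpha> ^^ (n - 1)) (xs ! 0)))" "drop 1 xs"] B.mult_linear_right
      by (simp add: coface_def)
  next
    case 3
    then show thesis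
      using that[of "\<lambda>y. y" "face \<mu>A \<alpha> i xs"] B.linear_ident by (simp add: coface_def)
  next
    case 4
    then show thesis
      using that[of "\<lambda>y. \<mu>B y (\<phi> ((\<alpha> ^^ (n - 1)) (xs ! n)))" "take n xs"] B.mult_linear_left
      by (simp add: coface_def)
  qed
qed

lemma coface_sum_scale:
  "coface n i (\<lambda>ys. \<Sum>j\<in>J. sB (c j) (g j ys)) xs = (\<Sum>j\<in>J. sB (c j) (coface n i (g j) xs))"
proof -
  obtain L ys where L: "Vector_Spaces.linear sB sB L" "\<And>f. coface n i f xs = L (f ys)"
    using coface_eq_linear by blast
  show ?thesis
    by (simp add: L BB.linear_sum[OF L(1)] BB.linear_scale[OF L(1)])
qed

lemma coface_add: "coface n i (\<lambda>ys. f ys + g ys) xs = coface n i f xs + coface n i g xs"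
proof -
  obtain L ys where L: "Vector_Spaces.linear sB sB L" "\<And>f. coface n i f xs = L (f ys)"
    using coface_eq_linear by blast
  show ?thesis
    by (simp add: L BB.linear_add[OF L(1)])
qed

lemma coface_scale: "coface n i (\<lambda>ys. sB r (f ys)) xs = sB r (coface n i f xs)"
proof -
  obtain L ys where L: "Vector_Spaces.linear sB sB L" "\<And>f. coface n i f xs = L (f ys)"
    using coface_eq_linear by blast
  show ?thesis
    by (simp add: L BB.linear_scale[OF L(1)])
qed

lemma hom_delta_add: "\<delta> n (\<lambda>ys. f ys + g ys) xs = \<delta> n f xs + \<delta> n g xs"
  by (cases "n = 0")
    (simp_all add: hom_delta_0 hom_delta_eq_sum_coface coface_add B.scale_right_distrib
      sum.distrib algebra_simps del: sum.atMost_Suc)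

lemma hom_delta_scale: "\<delta> n (\<lambda>ys. sB r (f ys)) xs = sB r (\<delta> n f xs)"
  by (cases "n = 0")
    (simp_all add: hom_delta_0 hom_delta_eq_sum_coface coface_scale B.scale_sum_right mult.commute
      del: sum.atMost_Suc)

lemma hom_delta_diff: "\<delta> n (\<lambda>ys. f ys - g ys) xs = \<delta> n f xs - \<delta> n g xs"
  using hom_delta_add[of n "\<lambda>ys. f ys - g ys" g xs] by simp

lemma cochain_twist: "f \<in> C n \<Longrightarrow> n \<ge> 1 \<Longrightarrow> length xs = n \<Longrightarrow> \<alpha>' (f xs) = f (map \<alpha> xs)"
  by (simp add: hom_cochains_def)

lemma cochain_linear:
  "f \<in> C n \<Longrightarrow> length xs = n \<Longrightarrow> i < n \<Longrightarrow> Vector_Spaces.linear sA sB (\<lambda>x. f (xs[i := x]))"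
  by (simp add: hom_cochains_def multilinear_map_def)

text \<open>Two inner cofaces reduce to \<open>face_face\<close>. When an outer coface is involved,
  its power of the twist is \<open>n - 1\<close> in degree \<open>n\<close> and \<open>n\<close> in
  degree \<open>n + 1\<close>; the missing twist comes from a face or from
  Hom-associativity.\<close>

lemma coface_coface:
  assumes f: "f \<in> C n" and n: "n \<ge> 1" and ij: "i < j" "j \<le> n + 2"
  shows "coface (n + 1) j (coface n i f) xs = coface (n + 1) i (coface n (j - 1) f) xs"
proof (cases "length xs = n + 2")
  case False
  then show ?thesis by (simp add: coface_def)
next
  case len: True
  have pow: "(\<alpha> ^^ (n - Suc 0)) (\<alpha> x) = (\<alpha> ^^ n) x" "\<alpha>' ((\<alpha>' ^^ (n - 1)) y) = (\<alpha>' ^^ n) y" for x y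
    using n by (cases n; simp add: funpow_swap1)+
  consider "i = 0" "j = 1" | "i = 0" "2 \<le> j" "j \<le> n + 1" | "i = 0" "j = n + 2"
    | "1 \<le> i" "j \<le> n + 1" | "1 \<le> i" "i \<le> n" "j = n + 2" | "i = n + 1" "j = n + 2"
    using ij by linarith
  then show ?thesis
  proof cases
    \<comment> \<open>The face at 1 twists all arguments of \<open>f\<close>; as \<open>f\<close>
      commutes with the twists, this becomes \<open>\<alpha>'\<close> on the value of
      \<open>f\<close>, the form that Hom-associativity in the target requires.\<close>
    case 1
    have "face \<mu>A \<alpha> 1 xs ! 0 = \<mu>A (xs ! 0) (xs ! 1)"
      using len by (simp add: nth_face)
    then show ?thesis
      using 1 len n drop_face_first[of xs \<mu>A \<alpha>] cochain_twist[OF f n, of "drop 2 xs"]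
      by (simp add: coface_def numeral_2_eq_2 hom_mult[symmetric] A.twist_power_mult hom_twist_power
          B.hom_assoc flip: pow(2))
  \<comment> \<open>The face does not merge the first argument but twists it, which raises the power
    of the twist from \<open>n - 1\<close> to \<open>n\<close>.\<close>
  next
    case 2
    have "j - 1 \<le> n" "face \<mu>A \<alpha> j xs ! 0 = \<alpha> (xs ! 0)"
      using 2 len by (simp_all add: nth_face)
    then show ?thesis
      using 2 len n drop_face[of j xs \<mu>A \<alpha>] by (simp add: coface_def pow(1))
  next
    \<comment> \<open>Left and right outer multiplication commute by Hom-associativity alone, with
      \<open>f\<close> evaluated on the middle arguments.\<close>
    case 3
    then show ?thesis
      using len n
      by (simp add: coface_def hom_twist_power B.hom_assoc drop_take flip: pow(2))
  next
    case 4
    then show ?thesis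
      using len n ij A.face_face[of i j xs] by (auto simp: coface_def)
  next
    case 5
    have "i - 1 < n" using 5 by simp
    then have "face \<mu>A \<alpha> i xs ! n = \<alpha> (xs ! Suc n)"
      using 5 len by (simp add: nth_face)
    then show ?thesis
      using 5 len n take_face[of i n xs \<mu>A \<alpha>] by (simp add: coface_def pow(1))
  next
    \<comment> \<open>The mirror image of the first case, with Hom-associativity used in the other
      direction.\<close>
    case 6
    have "face \<mu>A \<alpha> (Suc n) xs ! n = \<mu>A (xs ! n) (xs ! Suc n)"
      using len by (simp add: nth_face)
    then show ?thesis
      using 6 len n take_face_last[of xs n \<mu>A \<alpha>] cochain_twist[OF f n, of "take n xs"]
      by (simp add: coface_def hom_mult[symmetric] A.twist_power_mult hom_twist_power
          B.hom_assoc[symmetric] take_map[symmetric] flip: pow(2))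
  qed
qed

lemma hom_delta_hom_delta:
  assumes f: "f \<in> C n"
  shows "\<delta> (n + 1) (\<delta> n f) xs = 0"
proof (cases "n = 0")
  case True
  \<comment> \<open>Writing the zero function as a difference with itself lets
    \<open>hom_delta_diff\<close> show that the next differential kills it.\<close>
  have "\<delta> 0 f = (\<lambda>ys. \<delta> 0 f ys - \<delta> 0 f ys)" by (rule ext) (simp add: hom_delta_0)
  then show ?thesis
    using hom_delta_diff[of "n + 1" "\<delta> 0 f" "\<delta> 0 f" xs] True by simp
next
  case False
  then have n: "n \<ge> 1" by simp
  have "\<delta> n f = (\<lambda>ys. \<Sum>i\<le>Suc n. sB ((- 1) ^ i) (coface n i f ys))"
    using hom_delta_eq_sum_coface[OF n] by blast
  then have "\<delta> (n + 1) (\<delta> n f) xs =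
    (\<Sum>j\<le>Suc (Suc n). \<Sum>i\<le>Suc n. sB ((- 1) ^ j * (- 1) ^ i) (coface (Suc n) j (coface n i f) xs))"
    by (simp add: hom_delta_eq_sum_coface coface_sum_scale B.scale_sum_right del: sum.atMost_Suc)
  also have "\<dots> = 0"
    using coface_coface[OF f n] by (intro B.alternating_double_sum_eq_0) simp
  finally show ?thesis .
qed

section \<open>Closure of the cochain spaces under linear operations and the differential\<close>

lemma zero_in_cochains: "(\<lambda>_. 0) \<in> C n"
  using BB.linear_0[OF B.twist_linear]
  by (auto simp: hom_cochains_def multilinear_map_def AB.linear_zero)

lemma add_in_cochains: "f \<in> C n \<Longrightarrow> g \<in> C n \<Longrightarrow> (\<lambda>xs. f xs + g xs) \<in> C n"
  using BB.linear_add[OF B.twist_linear]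
  by (auto simp: hom_cochains_def multilinear_map_def intro: AB.linear_compose_add)

lemma scale_in_cochains: "f \<in> C n \<Longrightarrow> (\<lambda>xs. sB r (f xs)) \<in> C n"
  using BB.linear_scale[OF B.twist_linear]
  by (auto simp: hom_cochains_def multilinear_map_def intro: AB.linear_compose_scale_right)

lemma diff_in_cochains: "f \<in> C n \<Longrightarrow> g \<in> C n \<Longrightarrow> (\<lambda>xs. f xs - g xs) \<in> C n"
  using add_in_cochains[of f n "\<lambda>xs. sB (- 1) (g xs)"] scale_in_cochains[of g n "- 1"] by simp

lemma sum_in_cochains:
  "(\<And>i. i \<in> I \<Longrightarrow> g i \<in> C n) \<Longrightarrow> (\<lambda>xs. \<Sum>i\<in>I. g i xs) \<in> C n"
proof (induction I rule: infinite_finite_induct)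
  case (insert i I)
  then show ?case using add_in_cochains[of "g i" n "\<lambda>xs. \<Sum>i\<in>I. g i xs"] by simp
qed (auto simp: zero_in_cochains)

text \<open>Each argument enters a coface exactly once, so multilinearity comes from composing
  linear maps. Compatibility with the twists rests on multiplicativity: of the target for the outer
  cofaces, of the source for the inner ones.\<close>

lemma coface_in_cochains:
  assumes f: "f \<in> C n" and n: "n \<ge> 1" and i: "i \<le> Suc n"
  shows "coface n i f \<in> C (n + 1)"
proof -
  have pow_twist: "(\<alpha> ^^ k) (\<alpha> x) = \<alpha> ((\<alpha> ^^ k) x)" for k x
    by (simp add: funpow_swap1)
  have lin_pow: "Vector_Spaces.linear sA sB (\<lambda>x. \<phi> ((\<alpha> ^^ (n - 1)) x))"
    using Vector_Spaces.linear_compose[OF A.twist_power_linear[of "n - 1"] hom_linear]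
    by (simp add: o_def)
  have comp: "Vector_Spaces.linear sA sB (\<lambda>x. f (ys[m := g x]))"
    if "length ys = n" "m < n" "Vector_Spaces.linear sA sA g" for ys m g
    using Vector_Spaces.linear_compose[OF that(3) cochain_linear[OF f that(1,2)]]
    by (simp add: o_def)
  have "Vector_Spaces.linear sA sB (\<lambda>x. coface n i f (xs[m := x]))"
    if len: "length xs = n + 1" and m: "m < n + 1" for xs m
  proof -
    \<comment> \<open>For an outer coface, the varied entry is either the argument of
      \<open>\<phi>\<close> or one of the arguments of \<open>f\<close>.\<close>
    consider "i = 0" "m = 0" | "i = 0" "m > 0" | "1 \<le> i" "i \<le> n"
      | "i = Suc n" "m = n" | "i = Suc n" "m < n" using i m by linarith
    then show ?thesis
    proof cases
      case 1
      then show ?thesis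
        using len Vector_Spaces.linear_compose[OF lin_pow B.mult_linear_left[of "f (drop 1 xs)"]]
        by (simp add: coface_def o_def)
    next
      case 2
      then have "drop 1 (xs[m := x]) = (drop 1 xs)[m - 1 := x]" for x
        by (simp add: drop_update_swap)
      then show ?thesis
        using 2 len m Vector_Spaces.linear_compose[OF cochain_linear[OF f, of "drop 1 xs" "m - 1"]
            B.mult_linear_right[of "\<phi> ((\<alpha> ^^ (n - 1)) (xs ! 0))"]]
        by (simp add: coface_def o_def)
    next
      case 3
      then have "coface n i f (xs[m := x]) = f (face \<mu>A \<alpha> i (xs[m := x]))" for x
        using len by (simp add: coface_def)
      moreover have "Vector_Spaces.linear sA sB (\<lambda>x. f (face \<mu>A \<alpha> i (xs[m := x])))"
        using 3 len m
        by (cases "m < i - 1"; cases "m = i - 1"; cases "m = i")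
          (auto simp: face_list_update
            intro!: comp A.twist_linear A.mult_linear_left A.mult_linear_right)
      ultimately show ?thesis by simp
    next
      case 4
      then show ?thesis
        using len Vector_Spaces.linear_compose[OF lin_pow B.mult_linear_right[of "f (take n xs)"]]
        by (simp add: coface_def o_def)
    next
      case 5
      then have "take n (xs[m := x]) = (take n xs)[m := x]" for x
        by (simp add: take_update_swap)
      then show ?thesis
        using 5 len m Vector_Spaces.linear_compose[OF cochain_linear[OF f, of "take n xs" m]
            B.mult_linear_left[of "\<phi> ((\<alpha> ^^ (n - 1)) (xs ! n))"]]
        by (simp add: coface_def o_def)
    qed
  qed
  moreover have "\<alpha>' (coface n i f xs) = coface n i f (map \<alpha> xs)" if len: "length xs = n + 1" for xs
    using len n i cochain_twist[OF f n, of "drop 1 xs"] cochain_twist[OF f n, of "take n xs"]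
      cochain_twist[OF f n, of "face \<mu>A \<alpha> i xs"] map_face[of \<alpha> \<mu>A \<mu>A \<alpha> \<alpha> i xs]
    by (simp add: coface_def B.twist_mult A.twist_mult hom_twist[symmetric] pow_twist
        drop_map take_map)
  ultimately show ?thesis
    by (auto simp: hom_cochains_def multilinear_map_def coface_def)
qed

lemma hom_delta_in_cochains:
  assumes f: "f \<in> C n"
  shows "\<delta> n f \<in> C (n + 1)"
proof (cases "n = 0")
  case True
  then have "\<delta> n f = (\<lambda>_. 0)" by (intro ext) (simp add: hom_delta_0)
  then show ?thesis by (simp add: zero_in_cochains)
next
  case False
  then have n: "n \<ge> 1" by simp
  have "\<delta> n f = (\<lambda>xs. \<Sum>i\<le>Suc n. sB ((- 1) ^ i) (coface n i f xs))"
    using hom_delta_eq_sum_coface[OF n] by blast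
  then show ?thesis
    by (simp only:) (intro sum_in_cochains scale_in_cochains coface_in_cochains f n; simp)
qed

section \<open>Composition with \<phi> on either side as a cochain map\<close>

lemma hom_delta_compose_left:
  "\<delta> n (\<lambda>ys. \<phi> (f ys)) xs = \<phi> (hom_delta \<mu>A \<alpha> sA \<mu>A id n f xs)"
  using AB.linear_0[OF hom_linear]
  by (simp add: hom_delta_def AB.linear_add[OF hom_linear] AB.linear_diff[OF hom_linear]
      AB.linear_sum[OF hom_linear]
      AB.linear_scale[OF hom_linear] hom_mult)

text \<open>Faces commute with \<open>map \<phi>\<close> because \<open>\<phi>\<close> respects
  products and twists; in the outer terms \<open>\<phi>\<close> also passes through the powers of
  the twist.\<close>

lemma hom_delta_compose_right:
  "\<delta> n (\<lambda>ys. f (map \<phi> ys)) xs = hom_delta \<mu>B \<alpha>' sB \<mu>B id n f (map \<phi> xs)"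
proof -
  have "map \<phi> (face \<mu>A \<alpha> k xs) = face \<mu>B \<alpha>' k (map \<phi> xs)" if "1 \<le> k" "k < length xs" for k
    using that by (intro map_face) (auto simp: hom_mult hom_twist)
  then show ?thesis
    unfolding hom_delta_def face_def[symmetric]
    by (simp add: drop_map take_map hom_twist_power del: map_append)
qed

lemma compose_left_in_cochains:
  assumes "f \<in> hom_cochains sA \<alpha> sA \<alpha> n"
  shows "(\<lambda>xs. \<phi> (f xs)) \<in> C n"
proof -
  have "Vector_Spaces.linear sA sB (\<lambda>x. \<phi> (g x))" if "Vector_Spaces.linear sA sA g" for g
    using Vector_Spaces.linear_compose[OF that hom_linear] by (simp add: o_def)
  then show ?thesis
    using assms AB.linear_0[OF hom_linear]
    by (auto simp: hom_cochains_def multilinear_map_def hom_twist[symmetric])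
qed

lemma compose_right_in_cochains:
  assumes "f \<in> hom_cochains sB \<alpha>' sB \<alpha>' n"
  shows "(\<lambda>xs. f (map \<phi> xs)) \<in> C n"
proof -
  have "Vector_Spaces.linear sA sB (\<lambda>x. f ((map \<phi> xs)[i := \<phi> x]))"
    if "length xs = n" "i < n" for xs i
  proof -
    have "Vector_Spaces.linear sB sB (\<lambda>y. f ((map \<phi> xs)[i := y]))"
      using that assms by (simp add: hom_cochains_def multilinear_map_def)
    then show ?thesis
      using Vector_Spaces.linear_compose[OF hom_linear] by (fastforce simp: o_def)
  qed
  then show ?thesis
    using assms by (auto simp: hom_cochains_def multilinear_map_def map_update o_def hom_twist)
qed

text \<open>Specializing to the identity morphisms of both algebras transfers all results on
  \<open>\<delta>\<close> to the differentials of the first two components.\<close>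

sublocale IA: multiplicative_hom_assoc_morphism sA \<mu>A \<alpha> sA \<mu>A \<alpha> id
  by unfold_locales (auto simp: A.linear_id)

sublocale IB: multiplicative_hom_assoc_morphism sB \<mu>B \<alpha>' sB \<mu>B \<alpha>' id
  by unfold_locales (auto simp: B.linear_id)

section \<open>The mapping cone: the cochain complex of \<phi>\<close>

abbreviation "MC \<equiv> morphism_cochains sA \<alpha> sB \<alpha>'"

abbreviation "M\<delta> \<equiv> morphism_delta sA \<mu>A \<alpha> sB \<mu>B \<alpha>' \<phi>"

lemma morphism_delta_in_cochains:
  assumes "n \<ge> 1" "c \<in> MC n"
  shows "M\<delta> n c \<in> MC (n + 1)"
proof -
  obtain f1 f2 f3 where c: "c = (f1, f2, f3)" by (cases c)
  have f: "f1 \<in> hom_cochains sA \<alpha> sA \<alpha> n" "f2 \<in> hom_cochains sB \<alpha>' sB \<alpha>' n" "f3 \<in> C (n - 1)"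
    using assms(2) by (auto simp: c morphism_cochains_def)
  \<comment> \<open>Since \<open>n \<ge> 1\<close>, the truncated \<open>n - 1\<close> has successor
    \<open>n\<close>, the degree of the third component in \<open>MC (n + 1)\<close>. For
    \<open>n = 1\<close> this term is zero.\<close>
  have "\<delta> (n - 1) f3 \<in> C n"
    using hom_delta_in_cochains[OF f(3)] assms(1) by simp
  then have "(\<lambda>xs. \<phi> (f1 xs) - f2 (map \<phi> xs) - \<delta> (n - 1) f3 xs) \<in> C n"
    by (intro diff_in_cochains compose_left_in_cochains compose_right_in_cochains f)
  then show ?thesis
    using IA.hom_delta_in_cochains[OF f(1)] IB.hom_delta_in_cochains[OF f(2)]
    by (simp add: c morphism_delta_def morphism_cochains_def)
qed

text \<open>The first two components vanish as squares of differentials. In the third, the terms in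
  \<open>f1\<close> and \<open>f2\<close> cancel because both compositions with
  \<open>\<phi>\<close> are cochain maps, which leaves the square of \<open>\<delta>\<close> on
  \<open>f3\<close>.\<close>

lemma morphism_delta_morphism_delta:
  assumes "n \<ge> 1" "c \<in> MC n"
  shows "M\<delta> (n + 1) (M\<delta> n c) = 0"
proof -
  obtain f1 f2 f3 where c: "c = (f1, f2, f3)" by (cases c)
  have f: "f1 \<in> hom_cochains sA \<alpha> sA \<alpha> n" "f2 \<in> hom_cochains sB \<alpha>' sB \<alpha>' n" "f3 \<in> C (n - 1)"
    using assms(2) by (auto simp: c morphism_cochains_def)
  have "\<delta> n (\<delta> (n - 1) f3) xs = 0" for xs
    using hom_delta_hom_delta[OF f(3)] assms(1) by simp
  then show ?thesis
    using IA.hom_delta_hom_delta[OF f(1)] IB.hom_delta_hom_delta[OF f(2)]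
    by (simp add: c morphism_delta_def hom_delta_diff hom_delta_compose_left
        hom_delta_compose_right zero_prod_def zero_fun_def fun_eq_iff)
qed

lemma vector_space_morphism_scale: "vector_space (morphism_scale sA sB)"
  by unfold_locales
    (auto simp: morphism_scale_def fun_eq_iff A.scale_right_distrib A.scale_left_distrib
      B.scale_right_distrib B.scale_left_distrib)

lemma subspace_morphism_cochains: "module.subspace (morphism_scale sA sB) (MC n)"
proof -
  interpret M: vector_space "morphism_scale sA sB" by (rule vector_space_morphism_scale)
  show ?thesis
    unfolding M.subspace_def
    using zero_in_cochains IA.zero_in_cochains IB.zero_in_cochains
    by (auto simp: morphism_cochains_def morphism_scale_def zero_prod_def zero_fun_def plus_fun_def
        intro: add_in_cochains IA.add_in_cochains IB.add_in_cochains
          scale_in_cochains IA.scale_in_cochains IB.scale_in_cochains)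
qed

lemma morphism_delta_add: "M\<delta> n (c + c') = M\<delta> n c + M\<delta> n c'"
proof -
  obtain f1 f2 f3 where c: "c = (f1, f2, f3)" by (cases c)
  obtain g1 g2 g3 where c': "c' = (g1, g2, g3)" by (cases c')
  show ?thesis
    by (simp add: c c' morphism_delta_def fun_eq_iff plus_fun_def hom_delta_add
        IA.hom_delta_add IB.hom_delta_add AB.linear_add[OF hom_linear])
qed

lemma morphism_delta_scale:
  "M\<delta> n (morphism_scale sA sB r c) = morphism_scale sA sB r (M\<delta> n c)"
proof -
  obtain f1 f2 f3 where c: "c = (f1, f2, f3)" by (cases c)
  show ?thesis
    by (simp add: c morphism_delta_def morphism_scale_def fun_eq_iff hom_delta_scale
        IA.hom_delta_scale IB.hom_delta_scale AB.linear_scale[OF hom_linear]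
        B.scale_right_diff_distrib)
qed

lemma cochain_complex_morphism: "cochain_complex (morphism_scale sA sB) MC M\<delta>"
  using vector_space_morphism_scale subspace_morphism_cochains morphism_delta_in_cochains
    morphism_delta_add morphism_delta_scale morphism_delta_morphism_delta
  by (simp add: cochain_complex_def)

end

theorem theorem3p1:
  fixes sA :: "'k::{alg_closed_field, field_char_0} \<Rightarrow> 'a::ab_group_add \<Rightarrow> 'a"
    and \<mu>A :: "'a \<Rightarrow> 'a \<Rightarrow> 'a"
    and \<alpha> :: "'a \<Rightarrow> 'a"
    and sB :: "'k \<Rightarrow> 'b::ab_group_add \<Rightarrow> 'b"
    and \<mu>B :: "'b \<Rightarrow> 'b \<Rightarrow> 'b"
    and \<alpha>' :: "'b \<Rightarrow> 'b"
    and \<phi> :: "'a \<Rightarrow> 'b"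
  assumes "multiplicative_hom_assoc_algebra sA \<mu>A \<alpha>"
    and "multiplicative_hom_assoc_algebra sB \<mu>B \<alpha>'"
    and "hom_assoc_morphism sA \<mu>A \<alpha> sB \<mu>B \<alpha>' \<phi>"
  shows "(\<forall>n\<ge>1. \<forall>c \<in> morphism_cochains sA \<alpha> sB \<alpha>' n.
            morphism_delta sA \<mu>A \<alpha> sB \<mu>B \<alpha>' \<phi> n c \<in> morphism_cochains sA \<alpha> sB \<alpha>' (n + 1) \<and>
            morphism_delta sA \<mu>A \<alpha> sB \<mu>B \<alpha>' \<phi> (n + 1) (morphism_delta sA \<mu>A \<alpha> sB \<mu>B \<alpha>' \<phi> n c) = 0) \<and>
         cochain_complex (morphism_scale sA sB) (morphism_cochains sA \<alpha> sB \<alpha>')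
           (morphism_delta sA \<mu>A \<alpha> sB \<mu>B \<alpha>' \<phi>)"
proof -
  interpret multiplicative_hom_assoc_morphism sA \<mu>A \<alpha> sB \<mu>B \<alpha>' \<phi>
    using assms by (simp add: multiplicative_hom_assoc_morphism_def)
  show ?thesis
    using morphism_delta_in_cochains morphism_delta_morphism_delta cochain_complex_morphism
    by blast
qed

end
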